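(* Let $n,k\ge 1$ be integers and let $M$ be the $nk\times nk$ integer block matrix defined in the context. The function $f(b)=M\cdot b$ is injective on valid bid vectors: if $u=[u_1,\ldots,u_n]^T$ and $v=[v_1,\ldots,v_n]^T$ are two valid bid vectors (each $u_r$ and each $v_r$ being a vector of the canonical basis of $\mathbb{Z}^k$) with $u\neq v$, then $M\cdot u\neq M\cdot v$.
   Context: Let $(e_1,\ldots,e_k)$ be the canonical basis of $\mathbb{Z}^k$ (column vectors). Let $I=I_k$ be the $k\times k$ identity matrix, $L=L_k$ the $k\times k$ strictly lower triangular matrix with all entries strictly below the diagonal equal to $1$ and all other entries $0$, and $U=U_k$ the $k\times k$ strictly upper triangular matrix with all entries strictly above the diagonal equal to $1$ and all other entries $0$. Let $M$ be the $nk\times nk$ matrix consisting of $n\times n$ blocks of size $k\times k$, whose $(r,s)$ block is $U+L$ if $r=s$, $U$ if $r<s$, and $U+I$ if $r>s$. A valid (correct) bid vector is a column vector in $\mathbb{Z}^{nk}$ obtained by concatenating $n$ blocks of length $k$, where each block is one of the canonical basis vectors $e_1,\ldots,e_k$ (the $r$-th block being $e_j$ means that bidder $r$ bids price $j$). *)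

theory Defs
  imports "Jordan_Normal_Form.Matrix"
begin

text \<open>
  All indices are 0-based: blocks are numbered \<open>0, ..., n - 1\<close> and prices \<open>0, ..., k - 1\<close>.
\<close>

definition upper_ones :: "nat \<Rightarrow> int mat" where
  "upper_ones k = mat k k (\<lambda>(i, j). if i < j then 1 else 0)"

definition lower_ones :: "nat \<Rightarrow> int mat" where
  "lower_ones k = mat k k (\<lambda>(i, j). if j < i then 1 else 0)"

definition bid_block :: "nat \<Rightarrow> nat \<Rightarrow> nat \<Rightarrow> int mat" where
  "bid_block k r s =
     (if r = s then upper_ones k + lower_ones k
      else if r < s then upper_ones k
      else upper_ones k + 1\<^sub>m k)"

text \<open>
  Row \<open>i\<close> of the large matrix is row \<open>i mod k\<close> within block row \<open>i div k\<close>;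
  likewise for columns.
\<close>

definition bid_matrix :: "nat \<Rightarrow> nat \<Rightarrow> int mat" where
  "bid_matrix n k =
     mat (n * k) (n * k)
       (\<lambda>(i, j). bid_block k (i div k) (j div k) $$ (i mod k, j mod k))"

definition concat_vecs :: "'a :: zero vec list \<Rightarrow> 'a vec" where
  "concat_vecs us = foldr (@\<^sub>v) us (0\<^sub>v 0)"

definition valid_bid_vectors :: "nat \<Rightarrow> nat \<Rightarrow> int vec set" where
  "valid_bid_vectors n k =
     {concat_vecs us | us. length us = n \<and> set us \<subseteq> {unit_vec k j | j. j < k}}"

end

theory Submission
  imports Defs
begin

text \<open>
  Let bidder \<open>s\<close> bid \<open>p s\<close>, write \<open>P\<close> for the sum of all bids, and let \<open>c r i\<close> be the entry of
  the image at row \<open>i\<close> of block \<open>r\<close>. Each column of a diagonal block sums to \<open>k - 1\<close>, whereas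
  the \<open>p s\<close>-th column of \<open>U\<close> and of \<open>U + I\<close> sums to \<open>p s\<close> and \<open>p s + 1\<close>. Hence the entries of
  block \<open>r\<close> sum to \<open>k - 1 + r + P - p r\<close>, so two bids \<open>p\<close>, \<open>q\<close> with the same image differ by a
  constant: \<open>q = p + d\<close>. If \<open>d > 0\<close>, then \<open>c 0 (p 0)\<close> strictly increases from \<open>p\<close> to \<open>q\<close>: the
  diagonal block contributes \<open>0\<close> for \<open>p\<close> but \<open>1\<close> for \<open>q\<close>, and the contributions of the blocks
  \<open>U\<close> are monotone in the bid. By symmetry \<open>d = 0\<close>.
\<close>

definition bid_image :: "nat \<Rightarrow> (nat \<Rightarrow> nat) \<Rightarrow> nat \<Rightarrow> nat \<Rightarrow> int" where
  "bid_image n p r i =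
     (\<Sum>s<n. if r = s then of_bool (i \<noteq> p s)
             else if r < s then of_bool (i < p s) else of_bool (i \<le> p s))"

lemma concat_vecs_Cons: "concat_vecs (u # us) = u @\<^sub>v concat_vecs us"
  by (simp add: concat_vecs_def)

lemma dim_vec_concat_vecs:
  assumes "\<forall>u\<in>set us. dim_vec u = k"
  shows "dim_vec (concat_vecs us) = length us * k"
  using assms by (induction us) (simp_all add: concat_vecs_Cons, simp add: concat_vecs_def)

lemma index_concat_vecs:
  assumes "\<forall>u\<in>set us. dim_vec u = k" and "s < length us" and "j < k"
  shows "concat_vecs us $ (s * k + j) = us ! s $ j"
  using assms
proof (induction us arbitrary: s)
  case (Cons u us)
  have dim: "dim_vec (concat_vecs us) = length us * k"
    using Cons.prems(1) dim_vec_concat_vecs[of us k] by simp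
  \<comment> \<open>Keeps the index, once shifted past the head, inside the tail, as the index rule
    for \<open>@\<^sub>v\<close> demands.\<close>
  have lt: "m * k + j < l * k" if "m < l" for m l
    using that \<open>j < k\<close> mult_le_mono1[of "Suc m" l k] by simp
  show ?case
  proof (cases s)
    case 0
    then show ?thesis
      using Cons.prems by (simp add: concat_vecs_Cons)
  next
    case (Suc m)
    then show ?thesis
      using Cons.IH[of m] Cons.prems lt[of m "length us"] by (simp add: concat_vecs_Cons dim)
  qed
qed simp

lemma bid_block_index:
  assumes "i < k" and "j < k"
  shows "bid_block k r s $$ (i, j) =
    (if r = s then of_bool (i \<noteq> j) else if r < s then of_bool (i < j) else of_bool (i \<le> j))"
  using assms by (auto simp: bid_block_def upper_ones_def lower_ones_def)

text \<open>Grouping the columns by blocks, each unit vector selects column \<open>p s\<close> of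
  block \<open>(r, s)\<close>, which leaves the matrix-free sum for \<open>c r i\<close>.\<close>

lemma bid_matrix_mult_index:
  assumes p: "\<forall>s<n. p s < k" and "r < n" and "i < k"
  shows "(bid_matrix n k *\<^sub>v concat_vecs (map (\<lambda>s. unit_vec k (p s)) [0..<n])) $ (r * k + i)
    = bid_image n p r i"
proof -
  define us :: "int vec list" where "us = map (\<lambda>s. unit_vec k (p s)) [0..<n]"
  have us: "\<forall>u\<in>set us. dim_vec u = k" "length us = n"
    by (auto simp: us_def)
  have row: "r * k + i < n * k"
    using assms mult_le_mono1[of "Suc r" n k] by simp
  have dim: "dim_vec (concat_vecs us) = n * k"
    using us dim_vec_concat_vecs by blast
  have "(bid_matrix n k *\<^sub>v concat_vecs us) $ (r * k + i)
      = (\<Sum>t<n * k. bid_block k r (t div k) $$ (i, t mod k) * concat_vecs us $ t)"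
    using row \<open>i < k\<close>
    by (auto simp: bid_matrix_def scalar_prod_def dim atLeast0LessThan intro!: sum.cong)
  also have "\<dots> = (\<Sum>s<n. \<Sum>t = s * k..<s * k + k.
      bid_block k r (t div k) $$ (i, t mod k) * concat_vecs us $ t)"
    by (simp add: sum.nat_group)
  also have "\<dots> = (\<Sum>s<n. \<Sum>j<k. bid_block k r s $$ (i, j) * us ! s $ j)"
  proof (rule sum.cong[OF refl])
    fix s assume "s \<in> {..<n}"
    have "(\<Sum>t = s * k..<s * k + k. bid_block k r (t div k) $$ (i, t mod k) * concat_vecs us $ t)
      = (\<Sum>j<k. bid_block k r ((s * k + j) div k) $$ (i, (s * k + j) mod k)
          * concat_vecs us $ (s * k + j))"
      by (rule sum.reindex_bij_witness[of _ "\<lambda>j. s * k + j" "\<lambda>t. t - s * k"]) auto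
    also have "\<dots> = (\<Sum>j<k. bid_block k r s $$ (i, j) * us ! s $ j)"
      using us \<open>s \<in> {..<n}\<close> by (intro sum.cong refl) (simp add: index_concat_vecs)
    finally show "(\<Sum>t = s * k..<s * k + k.
        bid_block k r (t div k) $$ (i, t mod k) * concat_vecs us $ t) = \<dots>" .
  qed
  also have "\<dots> = (\<Sum>s<n. bid_block k r s $$ (i, p s))"
  proof (rule sum.cong[OF refl])
    fix s assume "s \<in> {..<n}"
    then have "(\<Sum>j<k. bid_block k r s $$ (i, j) * us ! s $ j)
        = (\<Sum>j<k. if j = p s then bid_block k r s $$ (i, j) else 0)"
      using p by (intro sum.cong refl) (auto simp: us_def unit_vec_def)
    then show "(\<Sum>j<k. bid_block k r s $$ (i, j) * us ! s $ j) = bid_block k r s $$ (i, p s)"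
      using p \<open>s \<in> {..<n}\<close> by simp
  qed
  also have "\<dots> = bid_image n p r i"
    unfolding bid_image_def using p \<open>i < k\<close> by (intro sum.cong refl) (simp add: bid_block_index)
  finally show ?thesis
    by (simp add: us_def)
qed

lemma sum_bid_image:
  assumes p: "\<forall>s<n. p s < k" and "r < n"
  shows "(\<Sum>i<k. bid_image n p r i) = int k - 1 + int r + (\<Sum>s<n. int (p s)) - int (p r)"
proof -
  have sets: "{..<k} \<inter> {i. i \<noteq> m} = {..<k} - {m}" "{..<k} \<inter> {i. i < m} = {..<m}"
    "{..<k} \<inter> {i. i \<le> m} = {..m}" if "m < k" for m
    using that by auto
  have card_ne: "int (card ({..<k} - {m})) = int k - 1" if "m < k" for m
    using that by (simp add: card_Diff_singleton of_nat_diff)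
  have "(\<Sum>i<k. bid_image n p r i) = (\<Sum>s<n. \<Sum>i<k. if r = s then of_bool (i \<noteq> p s)
      else if r < s then of_bool (i < p s) else of_bool (i \<le> p s))"
    unfolding bid_image_def by (rule sum.swap)
  \<comment> \<open>Every block is credited with the column sum \<open>p s\<close> of
    \<open>U\<close>. The corrections are \<open>1\<close> for the identity in \<open>U + I\<close>
    and \<open>k - 1 - p r\<close> on the diagonal.\<close>
  also have "\<dots> = (\<Sum>s<n. int (p s) + (if s < r then 1 else 0)
      + (if s = r then int k - 1 - int (p r) else 0))"
    using p by (intro sum.cong refl) (auto simp: of_bool_def sum.If_cases sets card_ne)
  also have "\<dots> = (\<Sum>s<n. int (p s)) + int (card ({..<n} \<inter> {s. s < r})) + (int k - 1 - int (p r))"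
    using \<open>r < n\<close> by (simp add: sum.distrib sum.If_cases)
  also have "{..<n} \<inter> {s. s < r} = {..<r}"
    using \<open>r < n\<close> by auto
  finally show ?thesis
    by simp
qed

lemma bid_image_0_less:
  assumes "0 < n" and "\<forall>s<n. p s < q s"
  shows "bid_image n p 0 (p 0) < bid_image n q 0 (p 0)"
  unfolding bid_image_def
proof (rule sum_strict_mono_ex1)
  show "\<exists>s\<in>{..<n}. (if 0 = s then of_bool (p 0 \<noteq> p s) else if 0 < s then of_bool (p 0 < p s)
      else of_bool (p 0 \<le> p s))
    < (if 0 = s then of_bool (p 0 \<noteq> q s) else if 0 < s then of_bool (p 0 < q s)
      else (of_bool (p 0 \<le> q s) :: int))"
    \<comment> \<open>The strict increase occurs at the diagonal block:
      \<open>p 0 \<noteq> p 0\<close> is false, while \<open>p 0 < q 0\<close> makes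
      \<open>p 0 \<noteq> q 0\<close> true.\<close>
    using assms by (intro bexI[of _ 0]) auto
qed (use assms less_trans in \<open>force+\<close>)

lemma bid_image_inject:
  assumes p: "\<forall>s<n. p s < k" and q: "\<forall>s<n. q s < k"
    and eq: "\<And>r i. r < n \<Longrightarrow> i < k \<Longrightarrow> bid_image n p r i = bid_image n q r i"
    and "r < n"
  shows "p r = q r"
proof -
  \<comment> \<open>Equating the sums over block \<open>s\<close> cancels \<open>k - 1 + s\<close>,
    so \<open>q s - p s\<close> is the difference of the two totals, whatever \<open>s\<close>
    is.\<close>
  define d where "d = (\<Sum>s<n. int (q s)) - (\<Sum>s<n. int (p s))"
  have shift: "int (q s) = int (p s) + d" if "s < n" for s
  proof -
    have "(\<Sum>i<k. bid_image n p s i) = (\<Sum>i<k. bid_image n q s i)"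
      using eq that by simp
    then show ?thesis
      using that by (simp add: sum_bid_image[OF p] sum_bid_image[OF q] d_def)
  qed
  have "0 < n"
    using \<open>r < n\<close> by simp
  have "\<not> d > 0"
  proof
    assume "d > 0"
    then have "\<forall>s<n. p s < q s"
      using shift by fastforce
    then show False
      using bid_image_0_less[OF \<open>0 < n\<close>, of p q] eq[of 0 "p 0"] p \<open>0 < n\<close> by simp
  qed
  moreover have "\<not> d < 0"
  proof
    assume "d < 0"
    then have "\<forall>s<n. q s < p s"
      using shift by fastforce
    \<comment> \<open>With the roles swapped, the images are compared at row \<open>q 0\<close>
      instead of \<open>p 0\<close>.\<close>
    then show False
      using bid_image_0_less[OF \<open>0 < n\<close>, of q p] eq[of 0 "q 0"] q \<open>0 < n\<close> by simp
  qed
  ultimately show ?thesis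
    using shift[OF \<open>r < n\<close>] by simp
qed

text \<open>Choosing a price for each unit vector turns a valid bid vector into a function
  \<open>p\<close>, the form in which images are computed above.\<close>

lemma valid_bid_vectorE:
  assumes "u \<in> valid_bid_vectors n k"
  obtains p where "\<forall>s<n. p s < k" and "u = concat_vecs (map (\<lambda>s. unit_vec k (p s)) [0..<n])"
proof -
  obtain us where us: "u = concat_vecs us" "length us = n" "set us \<subseteq> {unit_vec k j | j. j < k}"
    using assms by (auto simp: valid_bid_vectors_def)
  then have "\<forall>s<n. \<exists>j<k. us ! s = unit_vec k j"
    using nth_mem by fastforce
  then obtain p where p: "\<forall>s<n. p s < k \<and> us ! s = unit_vec k (p s)"
    by metis
  then have "us = map (\<lambda>s. unit_vec k (p s)) [0..<n]"
    using us(2) by (intro nth_equalityI) auto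
  then show thesis
    using that p us(1) by blast
qed

theorem theorem1:
  fixes n k :: nat
  assumes "n \<ge> 1" and "k \<ge> 1"
  shows "inj_on (\<lambda>b. bid_matrix n k *\<^sub>v b) (valid_bid_vectors n k)"
proof (rule inj_onI)
  fix u v
  assume u: "u \<in> valid_bid_vectors n k" and v: "v \<in> valid_bid_vectors n k"
    and eq: "bid_matrix n k *\<^sub>v u = bid_matrix n k *\<^sub>v v"
  obtain p where p: "\<forall>s<n. p s < k" "u = concat_vecs (map (\<lambda>s. unit_vec k (p s)) [0..<n])"
    using u by (rule valid_bid_vectorE)
  obtain q where q: "\<forall>s<n. q s < k" "v = concat_vecs (map (\<lambda>s. unit_vec k (q s)) [0..<n])"
    using v by (rule valid_bid_vectorE)
  have "bid_image n p r i = bid_image n q r i" if "r < n" "i < k" for r i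
    using bid_matrix_mult_index[OF p(1) that] bid_matrix_mult_index[OF q(1) that] p(2) q(2) eq
    by simp
  then have "p r = q r" if "r < n" for r
    using bid_image_inject[OF p(1) q(1)] that by blast
  then have "map (\<lambda>s. unit_vec k (p s)) [0..<n] = map (\<lambda>s. unit_vec k (q s)) [0..<n]"
    by simp
  then show "u = v"
    unfolding p(2) q(2) by (rule arg_cong)
qed

end
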